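(* For every $n \geq 1$, the mixed page number of the complete bipartite graph $K_{n,n}$ is at least $\lceil \frac{n}{3} \rceil$.
   Context: Given a total vertex order $\prec$, two edges $(a_1,b_1)$, $(a_2,b_2)$ with four distinct endpoints and $a_1\prec b_1$, $a_2 \prec b_2$, $a_1 \prec a_2$ are said to cross if $a_1 \prec a_2 \prec b_1 \prec b_2$, and to nest if $a_1 \prec a_2 \prec b_2 \prec b_1$. A stack is a set of edges no two of which cross; a queue is a set of edges no two of which nest. The mixed page number of a graph $G$ is the minimum value of $s+q$ such that there is a total order of the vertices of $G$ (arbitrary, not necessarily separating the parts) and a partition of its edges into $s$ stacks and $q$ queues with respect to that order. *)

theory Defs
  imports Graph_Theory.Kuratowski "HOL-Library.Disjoint_Sets"
begin

text \<open>
  Graphs are those of Graph_Theory, where an undirected edge is a pair of opposite arcs.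
  A pair of opposite arcs must be assigned to a single page, so pages consist of undirected edges.
\<close>

definition uedges :: "('a, 'b) pre_digraph \<Rightarrow> 'a set set" where
  "uedges G = {{u, v} |u v. (u, v) \<in> arcs_ends G}"

text \<open>
  Below, \<open>r\<close> is the strict vertex order. For irreflexive and transitive \<open>r\<close> the chains force the
  four endpoints to be distinct, as well as \<open>a\<^sub>1 \<prec> b\<^sub>1\<close> and \<open>a\<^sub>2 \<prec> b\<^sub>2\<close>. The two predicates
  name the edge with the smaller first endpoint first; stacks and queues range over both orders
  of each pair of edges.
\<close>

definition crosses :: "'a rel \<Rightarrow> 'a set \<Rightarrow> 'a set \<Rightarrow> bool" where
  "crosses r e f \<longleftrightarrow> (\<exists>a\<^sub>1 b\<^sub>1 a\<^sub>2 b\<^sub>2. e = {a\<^sub>1, b\<^sub>1} \<and> f = {a\<^sub>2, b\<^sub>2} \<and>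
     (a\<^sub>1, a\<^sub>2) \<in> r \<and> (a\<^sub>2, b\<^sub>1) \<in> r \<and> (b\<^sub>1, b\<^sub>2) \<in> r)"

definition nests :: "'a rel \<Rightarrow> 'a set \<Rightarrow> 'a set \<Rightarrow> bool" where
  "nests r e f \<longleftrightarrow> (\<exists>a\<^sub>1 b\<^sub>1 a\<^sub>2 b\<^sub>2. e = {a\<^sub>1, b\<^sub>1} \<and> f = {a\<^sub>2, b\<^sub>2} \<and>
     (a\<^sub>1, a\<^sub>2) \<in> r \<and> (a\<^sub>2, b\<^sub>2) \<in> r \<and> (b\<^sub>2, b\<^sub>1) \<in> r)"

definition is_stack :: "'a rel \<Rightarrow> 'a set set \<Rightarrow> bool" where
  "is_stack r S \<longleftrightarrow> (\<forall>e\<in>S. \<forall>f\<in>S. \<not> crosses r e f)"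

definition is_queue :: "'a rel \<Rightarrow> 'a set set \<Rightarrow> bool" where
  "is_queue r Q \<longleftrightarrow> (\<forall>e\<in>Q. \<forall>f\<in>Q. \<not> nests r e f)"

definition mixed_layout :: "('a, 'b) pre_digraph \<Rightarrow> nat \<Rightarrow> nat \<Rightarrow> bool" where
  "mixed_layout G s q \<longleftrightarrow>
     (\<exists>r. strict_linear_order_on (verts G) r \<and>
       (\<exists>\<S> \<Q>. finite \<S> \<and> card \<S> = s \<and> (\<forall>S\<in>\<S>. is_stack r S) \<and>
              finite \<Q> \<and> card \<Q> = q \<and> (\<forall>Q\<in>\<Q>. is_queue r Q) \<and>
              \<S> \<inter> \<Q> = {} \<and> partition_on (uedges G) (\<S> \<union> \<Q>)))"

definition mixed_page_number :: "('a, 'b) pre_digraph \<Rightarrow> nat" where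
  "mixed_page_number G = (LEAST k. \<exists>s q. k = s + q \<and> mixed_layout G s q)"

text \<open>The minimum is over a nonempty set, so the \<open>LEAST\<close> above is meaningful.\<close>

lemma mixed_page_number_attained:
  assumes "graph G"
  shows "\<exists>s q. mixed_page_number G = s + q \<and> mixed_layout G s q"
proof -
  interpret graph G by fact
  obtain r where r: "well_order_on (verts G) r"
    using well_order_on by blast
  then have lin: "linear_order_on (verts G) r"
    by (simp add: well_order_on_def)
  have tr: "trans r" and an: "antisym r" and tot: "total_on (verts G) r"
    using lin by (auto simp: linear_order_on_def partial_order_on_def preorder_on_def)
  have strict: "strict_linear_order_on (verts G) (r - Id)"
    unfolding strict_linear_order_on_def
    using trans_diff_Id[OF tr an] tot by (auto simp: irrefl_def total_on_def)
  have fin: "finite (uedges G)"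
  proof -
    have "uedges G = (\<lambda>(u, v). {u, v}) ` arcs_ends G"
      by (auto simp: uedges_def)
    then show ?thesis
      by (simp add: arcs_ends_def)
  qed
  have single: "is_stack (r - Id) {e}" for e
    using tr an by (auto simp: is_stack_def crosses_def doubleton_eq_iff dest: antisymD transD)
  have "mixed_layout G (card ((\<lambda>e. {e}) ` uedges G)) 0"
    unfolding mixed_layout_def
  proof (intro exI conjI)
    show "partition_on (uedges G) ((\<lambda>e. {e}) ` uedges G \<union> {})"
      by (auto simp: partition_on_def disjoint_def)
  qed (use strict fin single in auto)
  then have "\<exists>k s q. k = s + q \<and> mixed_layout G s q"
    by blast
  then show ?thesis
    unfolding mixed_page_number_def by (rule LeastI_ex)
qed

end

theory Submission
  imports Defs
begin

text \<open>
  Number the \<open>N = 2n\<close> vertices along the order and colour them by their part; the \<open>n\<^sup>2\<close> edges are the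
  bichromatic pairs \<open>i < j\<close>. Let \<open>M\<close> be the number of bichromatic sides of the polygon on
  \<open>0, \<dots>, N - 1\<close>.

  A stack is an outerplanar bipartite graph, so it has at most \<open>N - 2 - M/2\<close> edges that are not sides;
  as the sides are counted only once, \<open>s \<ge> 2\<close> stacks cover at most \<open>s (2n - 2)\<close> edges.

  The edges of a queue have distinct sums \<open>i + j\<close>. There are about \<open>2N\<close> sums, but few edges with an
  extreme sum: take the shortest prefix that has \<open>q\<close> vertices of one colour and hence \<open>b \<le> q\<close> of the
  other. The edges with sum below \<open>2q + b\<close> are among the \<open>q b\<close> edges inside this prefix and at most
  \<open>q (q + 1) / 2\<close> others, although \<open>q\<close> queues could use each sum \<open>q\<close> times. Applying this at both
  ends, \<open>q\<close> queues cover at most \<open>4nq - 3q\<^sup>2\<close> edges.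

  Together, \<open>(n - q) (n - 3q) \<le> s (2n - 2)\<close>, which is impossible for \<open>n > 3 (s + q)\<close>. With a single
  stack the sides are not absorbed; there one uses that the queue bound improves by the number of
  minority vertices among the first and last \<open>q\<close> vertices, and that few such vertices force \<open>M\<close> to
  be small.
\<close>

section \<open>Edges and pages as sets of index pairs\<close>

definition bichromatic :: "(nat \<Rightarrow> bool) \<Rightarrow> nat \<Rightarrow> nat \<Rightarrow> (nat \<times> nat) set" where
  "bichromatic c l r = {(i, j). l \<le> i \<and> i < j \<and> j < r \<and> c i \<noteq> c j}"

definition noncrossing :: "(nat \<times> nat) set \<Rightarrow> bool" where
  "noncrossing X \<longleftrightarrow> (\<forall>(i, j)\<in>X. \<forall>(i', j')\<in>X. \<not> (i < i' \<and> i' < j \<and> j < j'))"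

definition nonnesting :: "(nat \<times> nat) set \<Rightarrow> bool" where
  "nonnesting X \<longleftrightarrow> (\<forall>(i, j)\<in>X. \<forall>(i', j')\<in>X. \<not> (i < i' \<and> i' < j' \<and> j' < j))"

definition changes :: "(nat \<Rightarrow> bool) \<Rightarrow> nat \<Rightarrow> nat \<Rightarrow> nat" where
  "changes c l r = (\<Sum>i=l..<r. of_bool (c i \<noteq> c (Suc i)))"

definition colour_count :: "(nat \<Rightarrow> bool) \<Rightarrow> bool \<Rightarrow> nat \<Rightarrow> nat" where
  "colour_count c b w = card {i. i < w \<and> c i = b}"

lemma finite_bichromatic [simp]: "finite (bichromatic c l r)"
  by (rule finite_subset[of _ "{..<r} \<times> {..<r}"]) (auto simp: bichromatic_def)

lemma noncrossingD:
  "noncrossing X \<Longrightarrow> (i, j) \<in> X \<Longrightarrow> (i', j') \<in> X \<Longrightarrow> \<not> (i < i' \<and> i' < j \<and> j < j')"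
  unfolding noncrossing_def by blast

lemma noncrossing_subset: "noncrossing X \<Longrightarrow> Y \<subseteq> X \<Longrightarrow> noncrossing Y"
  unfolding noncrossing_def by blast

lemma nonnestingD:
  "nonnesting X \<Longrightarrow> (i, j) \<in> X \<Longrightarrow> (i', j') \<in> X \<Longrightarrow> \<not> (i < i' \<and> i' < j' \<and> j' < j)"
  unfolding nonnesting_def by blast

lemma changes_split: "l \<le> k \<Longrightarrow> k \<le> r \<Longrightarrow> changes c l r = changes c l k + changes c k r"
  unfolding changes_def by (rule sum.atLeastLessThan_concat[symmetric])

lemma changes_le: "changes c l r \<le> r - l"
proof -
  have "changes c l r \<le> (\<Sum>i=l..<r. 1)"
    unfolding changes_def by (rule sum_mono) auto
  then show ?thesis by simp
qed

section \<open>Noncrossing sets and the bound for stacks\<close>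

text \<open>Take \<open>k\<close> to be the last neighbour of \<open>l\<close> before
  \<open>r\<close>. An edge passing over \<open>k\<close> must start at \<open>l\<close>, or it
  would cross \<open>(l, k)\<close>, and by maximality it then ends at \<open>r\<close>. If
  \<open>l\<close> has no such neighbour, \<open>k = l + 1\<close> works.\<close>

lemma noncrossing_split:
  assumes X: "X \<subseteq> bichromatic c l (Suc r)" and nc: "noncrossing X" and "l + 1 < r"
  obtains k where "l < k" "k < r"
    "X \<subseteq> insert (l, r) ((X \<inter> bichromatic c l (Suc k)) \<union> (X \<inter> bichromatic c k (Suc r)))"
proof -
  let ?K = "{k. k < r \<and> (l, k) \<in> X}"
  note split = that
  have *: thesis if k: "l < k" "k < r"
    and no: "\<And>i j. (i, j) \<in> X \<Longrightarrow> i < k \<Longrightarrow> k < j \<Longrightarrow> (i, j) = (l, r)" for k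
  proof (rule split[OF k], rule subsetI)
    fix e assume e: "e \<in> X"
    obtain i j where ij: "e = (i, j)" by (cases e)
    have b: "l \<le> i" "i < j" "j < Suc r" "c i \<noteq> c j"
      using e ij X by (auto simp: bichromatic_def)
    consider "j \<le> k" | "k \<le> i" | "i < k" "k < j" by linarith
    then show "e \<in> insert (l, r) ((X \<inter> bichromatic c l (Suc k)) \<union> (X \<inter> bichromatic c k (Suc r)))"
      using e ij b no[of i j] by cases (auto simp: bichromatic_def)
  qed
  show thesis
  proof (cases "?K = {}")
    case True
    show thesis
    proof (rule *[of "l + 1"])
      fix i j assume ij: "(i, j) \<in> X" "i < l + 1" "l + 1 < j"
      then have "i = l" "j \<le> r" using X by (auto simp: bichromatic_def)
      moreover have "\<not> j < r" using ij True \<open>i = l\<close> by blast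
      ultimately show "(i, j) = (l, r)" by simp
    qed (use \<open>l + 1 < r\<close> in auto)
  next
    case False
    have fin: "finite ?K" by simp
    define k where "k = Max ?K"
    have k: "k < r" "(l, k) \<in> X" using Max_in[OF fin False] by (auto simp: k_def)
    show thesis
    proof (rule *[of k])
      show "l < k" using k X by (auto simp: bichromatic_def)
      fix i j assume ij: "(i, j) \<in> X" "i < k" "k < j"
      then have b: "l \<le> i" "j \<le> r" using X by (auto simp: bichromatic_def)
      have "i = l" using noncrossingD[OF nc k(2) ij(1)] ij b by linarith
      moreover have "\<not> j < r"
      proof
        assume "j < r"
        then have "j \<in> ?K" using ij \<open>i = l\<close> by simp
        then have "j \<le> k" unfolding k_def using fin by simp
        then show False using ij by simp
      qed
      ultimately show "(i, j) = (l, r)" using b by simp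
    qed (use k in auto)
  qed
qed

text \<open>This is Euler's bound for an outerplanar bipartite graph, sharpened by the number of sides of
  the polygon \<open>l, \<dots>, r\<close> that may be edges at all.\<close>

lemma card_noncrossing:
  assumes "l < r" and "X \<subseteq> bichromatic c l (Suc r)" and "noncrossing X"
  shows "2 * card X + 2 \<le> 2 * (r - l) + changes c l r + of_bool (c l \<noteq> c r)"
  using assms
proof (induction "r - l" arbitrary: l r X rule: less_induct)
  case less
  note X = less.prems(2) and nc = less.prems(3)
  show ?case
  proof (cases "l + 1 < r")
    case False
    then have r: "r = Suc l" using less.prems by simp
    have "X \<subseteq> (if c l \<noteq> c r then {(l, r)} else {})"
      using X r by (auto simp: bichromatic_def le_Suc_eq less_Suc_eq)
    then have "card X \<le> card (if c l \<noteq> c r then {(l, r)} else {})"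
      by (rule card_mono[rotated]) auto
    then show ?thesis using r by (auto simp: changes_def split: if_splits)
  next
    case True
    obtain k where k: "l < k" "k < r" and
      sub: "X \<subseteq> insert (l, r) ((X \<inter> bichromatic c l (Suc k)) \<union> (X \<inter> bichromatic c k (Suc r)))"
      by (rule noncrossing_split[OF X nc True])
    let ?L = "X \<inter> bichromatic c l (Suc k)" and ?R = "X \<inter> bichromatic c k (Suc r)"
    let ?e = "of_bool (c l \<noteq> c r) :: nat"
    have L: "2 * card ?L + 2 \<le> 2 * (k - l) + changes c l k + of_bool (c l \<noteq> c k)"
      by (rule less.hyps) (use k noncrossing_subset[OF nc] in auto)
    have R: "2 * card ?R + 2 \<le> 2 * (r - k) + changes c k r + of_bool (c k \<noteq> c r)"
      by (rule less.hyps) (use k noncrossing_subset[OF nc] in auto)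
    have "X \<subseteq> (if c l \<noteq> c r then {(l, r)} else {}) \<union> (?L \<union> ?R)"
      using sub X by (auto simp: bichromatic_def)
    then have "card X \<le> card ((if c l \<noteq> c r then {(l, r)} else {}) \<union> (?L \<union> ?R))"
      by (rule card_mono[rotated]) auto
    also have "\<dots> \<le> card (if c l \<noteq> c r then {(l, r)} else {}) + card (?L \<union> ?R)"
      by (rule card_Un_le)
    also have "\<dots> \<le> ?e + (card ?L + card ?R)"
      using card_Un_le[of ?L ?R] by auto
    finally have "card X \<le> ?e + card ?L + card ?R" by simp
    \<comment> \<open>Parity with two colours: among the three pairs from \<open>l\<close>,
      \<open>k\<close>, \<open>r\<close>, either none or exactly two are bichromatic. This pays for
      the edge \<open>(l, r)\<close>.\<close>
    moreover have "of_bool (c l \<noteq> c k) + of_bool (c k \<noteq> c r) + 2 * ?e \<le> (2::nat) + ?e"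
      by auto
    moreover have "changes c l r = changes c l k + changes c k r"
      using k by (intro changes_split) auto
    ultimately show ?thesis using L R k by linarith
  qed
qed

text \<open>All bichromatic sides of the polygon, whether or not a given page contains them;
  \<open>(0, r)\<close> is the closing side.\<close>

definition boundary :: "(nat \<Rightarrow> bool) \<Rightarrow> nat \<Rightarrow> (nat \<times> nat) set" where
  "boundary c r = {(i, j) \<in> bichromatic c 0 (Suc r). j = Suc i \<or> (i, j) = (0, r)}"

lemma finite_boundary [simp]: "finite (boundary c r)"
  by (rule finite_subset[OF _ finite_bichromatic[of c 0 "Suc r"]]) (auto simp: boundary_def)

lemma card_boundary:
  assumes "1 < r"
  shows "card (boundary c r) = changes c 0 r + of_bool (c 0 \<noteq> c r)"
proof -
  let ?S = "{i \<in> {0..<r}. c i \<noteq> c (Suc i)}"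
  let ?T = "if c 0 \<noteq> c r then {(0 :: nat, r)} else {}"
  have "boundary c r = (\<lambda>i. (i, Suc i)) ` ?S \<union> ?T"
    using assms by (auto simp: boundary_def bichromatic_def)
  moreover have "card ((\<lambda>i. (i, Suc i)) ` ?S \<union> ?T) = card ((\<lambda>i. (i, Suc i)) ` ?S) + card ?T"
    by (intro card_Un_disjoint) (use assms in auto)
  moreover have "card ((\<lambda>i. (i, Suc i)) ` ?S) = card ?S"
    by (intro card_image) (auto simp: inj_on_def)
  moreover have "card ?S = changes c 0 r"
    unfolding changes_def by (simp add: sum.If_cases of_bool_def Int_def)
  ultimately show ?thesis by simp
qed

text \<open>No index lies strictly between the ends of \<open>(i, Suc i)\<close> or outside those of
  \<open>(0, r)\<close>, so a side crosses nothing. Every stack may therefore be filled up with all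
  sides before its size is bounded.\<close>

lemma noncrossing_Un_boundary:
  assumes "X \<subseteq> bichromatic c 0 (Suc r)" "noncrossing X"
  shows "noncrossing (X \<union> boundary c r)"
  using assms unfolding noncrossing_def boundary_def bichromatic_def by fastforce

text \<open>Filled up with the \<open>M\<close> sides, a stack has at most
  \<open>r - 1 + M/2\<close> edges, hence at most \<open>r - 1 - M/2\<close> that are not sides.
  Summing these over the stacks and adding the sides once gives the bound.\<close>

lemma card_Union_noncrossing:
  assumes r: "1 < r" and fin: "finite \<S>" and ne: "\<S> \<noteq> {}"
    and S: "\<And>X. X \<in> \<S> \<Longrightarrow> X \<subseteq> bichromatic c 0 (Suc r) \<and> noncrossing X"
  defines "M \<equiv> changes c 0 r + of_bool (c 0 \<noteq> c r)"
  shows "2 * int (card (\<Union>\<S>)) \<le> int (card \<S>) * (2 * int r - 2 - int M) + 2 * int M"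
proof -
  let ?B = "boundary c r"
  have fX: "finite X" if "X \<in> \<S>" for X
    using S[OF that] finite_subset finite_bichromatic by blast
  have one: "2 * int (card (X - ?B)) \<le> 2 * int r - 2 - int M" if X: "X \<in> \<S>" for X
  proof -
    have "X \<union> ?B \<subseteq> bichromatic c 0 (Suc r)"
      using S[OF X] by (auto simp: boundary_def)
    then have "2 * card (X \<union> ?B) + 2 \<le> 2 * (r - 0) + changes c 0 r + of_bool (c 0 \<noteq> c r)"
      using S[OF X] r by (intro card_noncrossing noncrossing_Un_boundary) auto
    moreover have "card (X \<union> ?B) = card (X - ?B) + card ?B"
      using fX[OF X] by (subst card_Un_disjoint[symmetric]) auto
    ultimately show ?thesis
      using card_boundary[OF r, of c] unfolding M_def by linarith
  qed
  have "\<Union>\<S> \<subseteq> (\<Union>X\<in>\<S>. X - ?B) \<union> ?B" by auto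
  then have "card (\<Union>\<S>) \<le> card ((\<Union>X\<in>\<S>. X - ?B) \<union> ?B)"
    by (rule card_mono[rotated]) (use fin fX in auto)
  also have "\<dots> \<le> card (\<Union>X\<in>\<S>. X - ?B) + card ?B" by (rule card_Un_le)
  also have "\<dots> \<le> (\<Sum>X\<in>\<S>. card (X - ?B)) + card ?B"
    by (intro add_right_mono card_UN_le fin)
  finally have "int (card (\<Union>\<S>)) \<le> int ((\<Sum>X\<in>\<S>. card (X - ?B)) + card ?B)"
    by (rule of_nat_mono)
  then have "2 * int (card (\<Union>\<S>)) \<le> (\<Sum>X\<in>\<S>. 2 * int (card (X - ?B))) + 2 * int (card ?B)"
    by (simp flip: sum_distrib_left)
  also have "(\<Sum>X\<in>\<S>. 2 * int (card (X - ?B))) \<le> (\<Sum>X\<in>\<S>. 2 * int r - 2 - int M)"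
    by (rule sum_mono) (rule one)
  finally show ?thesis using card_boundary[OF r, of c] by (simp add: M_def)
qed

section \<open>Colour counts of prefixes\<close>

lemma colour_count_0 [simp]: "colour_count c b 0 = 0"
  by (simp add: colour_count_def)

lemma colour_count_Suc: "colour_count c b (Suc w) = colour_count c b w + of_bool (c w = b)"
proof -
  have "{i. i < Suc w \<and> c i = b} = {i. i < w \<and> c i = b} \<union> (if c w = b then {w} else {})"
    by (auto simp: less_Suc_eq)
  then show ?thesis by (auto simp: colour_count_def)
qed

lemma colour_count_add: "colour_count c True w + colour_count c False w = w"
  by (induction w) (auto simp: colour_count_Suc)

lemma colour_count_le: "colour_count c b w \<le> w"
  using colour_count_add[of c w] by (cases b) auto

text \<open>Each change has exactly one end of colour \<open>b\<close>, and a vertex takes part in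
  at most two changes.\<close>

lemma changes_le_colour_count: "changes c 0 (q - 1) \<le> 2 * colour_count c b q"
proof (cases q)
  case (Suc w)
  \<comment> \<open>Strengthened for the induction: a last vertex of colour \<open>b\<close> still
    has its right-hand change to spend.\<close>
  have "changes c 0 w + of_bool (c w = b) \<le> 2 * colour_count c b (Suc w)"
    by (induction w) (auto simp: changes_def colour_count_Suc)
  then show ?thesis using Suc by simp
qed (simp add: changes_def)

text \<open>A discrete intermediate value argument: the larger colour count grows by at most one per
  vertex and has reached \<open>q\<close> after \<open>2 * q\<close> vertices.\<close>

lemma exists_prefix_max_colour_count:
  obtains u b where "q \<le> u" "u \<le> 2 * q" "colour_count c b u = q" "colour_count c (\<not> b) u = u - q"
proof -
  define f where "f u = max (colour_count c True u) (colour_count c False u)" for u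
  have top: "f (2 * q) \<ge> q" using colour_count_add[of c "2 * q"] by (auto simp: f_def)
  have step: "f (Suc u) \<le> f u + 1" for u by (auto simp: f_def colour_count_Suc)
  have "\<exists>u\<le>2 * q. f u = q"
  proof -
    define u where "u = (LEAST u. q \<le> f u)"
    have u: "q \<le> f u" "u \<le> 2 * q"
      using top unfolding u_def by (auto intro: LeastI Least_le)
    have "f u \<le> q"
    proof (cases u)
      case (Suc w)
      then have "\<not> q \<le> f w" using not_less_Least[of w "\<lambda>u. q \<le> f u"] by (simp add: u_def)
      then show ?thesis using step[of w] Suc by simp
    qed (simp add: f_def)
    with u show ?thesis by (auto intro!: exI[of _ u])
  qed
  then obtain u where u: "u \<le> 2 * q" "f u = q" by blast
  have "f u \<in> {colour_count c True u, colour_count c False u}" by (auto simp: f_def max_def)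
  then obtain b where b: "colour_count c b u = q" using u by auto
  then have "colour_count c (\<not> b) u = u - q"
    using colour_count_add[of c u] by (cases b) auto
  then show thesis using that[of u b] u(1) b colour_count_le[of c b u] by blast
qed

lemma card_bichromatic:
  "card (bichromatic c 0 w) = colour_count c True w * colour_count c False w"
proof (induction w)
  case 0
  then show ?case by (simp add: bichromatic_def)
next
  case (Suc w)
  let ?N = "(\<lambda>i. (i, w)) ` {i. i < w \<and> c i = (\<not> c w)}"
  have "bichromatic c 0 (Suc w) = bichromatic c 0 w \<union> ?N"
    by (auto simp: bichromatic_def less_Suc_eq)
  moreover have "card (bichromatic c 0 w \<union> ?N) = card (bichromatic c 0 w) + card ?N"
    by (intro card_Un_disjoint finite_bichromatic) (auto simp: bichromatic_def)
  moreover have "card ?N = colour_count c (\<not> c w) w"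
    unfolding colour_count_def by (intro card_image) (auto simp: inj_on_def)
  ultimately show ?case using Suc by (cases "c w") (auto simp: colour_count_Suc)
qed

section \<open>Edges with small index sum\<close>

definition minority :: "(nat \<Rightarrow> bool) \<Rightarrow> nat \<Rightarrow> nat" where
  "minority c w = min (colour_count c True w) (colour_count c False w)"

definition low :: "(nat \<Rightarrow> bool) \<Rightarrow> nat \<Rightarrow> (nat \<times> nat) set" where
  "low c t = {(i, j). i < j \<and> c i \<noteq> c j \<and> i + j < t}"

lemma finite_low [simp]: "finite (low c t)"
  by (rule finite_subset[of _ "{..<t} \<times> {..<t}"]) (auto simp: low_def)

text \<open>Such an edge lies inside the first \<open>u\<close> vertices, where there are
  \<open>q * (u - q)\<close> edges, or it ends at some \<open>u + d\<close> and starts below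
  \<open>q - d\<close>. The second kind numbers at most \<open>q * (q + 1) / 2\<close>, less what
  the colours rule out in row 0.\<close>

lemma card_low:
  assumes u: "q \<le> u" and b: "colour_count c b u = q" "colour_count c (\<not> b) u = u - q"
  shows "2 * card (low c (u + q)) + 2 * minority c q \<le> 2 * (q * (u - q)) + q * (q + 1)"
proof -
  let ?row = "\<lambda>d. (\<lambda>i. (i, u + d)) ` {i. i < q - d \<and> c i = (\<not> c (u + d))}"
  have sub: "low c (u + q) \<subseteq> bichromatic c 0 u \<union> (\<Union>d<q. ?row d)"
  proof (rule subsetI)
    fix e assume "e \<in> low c (u + q)"
    then obtain i j where e: "e = (i, j)" "i < j" "c i \<noteq> c j" "i + j < u + q"
      by (auto simp: low_def)
    show "e \<in> bichromatic c 0 u \<union> (\<Union>d<q. ?row d)"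
    proof (cases "j < u")
      case True
      then show ?thesis using e by (auto simp: bichromatic_def)
    next
      case False
      then have "j = u + (j - u)" "j - u < q" "i < q - (j - u)" using e by auto
      then have "e \<in> ?row (j - u)" using e by auto
      then show ?thesis using \<open>j - u < q\<close> by blast
    qed
  qed
  have row: "card (?row d) = colour_count c (\<not> c (u + d)) (q - d)" for d
    unfolding colour_count_def by (intro card_image) (auto simp: inj_on_def)
  have "card (low c (u + q)) \<le> card (bichromatic c 0 u \<union> (\<Union>d<q. ?row d))"
    by (rule card_mono[OF _ sub]) auto
  also have "\<dots> \<le> card (bichromatic c 0 u) + card (\<Union>d<q. ?row d)"
    by (rule card_Un_le)
  also have "card (bichromatic c 0 u) = q * (u - q)"
    using b by (cases b) (auto simp: card_bichromatic)
  also have "card (\<Union>d<q. ?row d) \<le> (\<Sum>d<q. colour_count c (\<not> c (u + d)) (q - d))"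
    using card_UN_le[of "{..<q}" ?row] row by simp
  finally have "card (low c (u + q)) \<le>
      q * (u - q) + (\<Sum>d<q. colour_count c (\<not> c (u + d)) (q - d))" by simp
  moreover have "2 * (\<Sum>d<q. colour_count c (\<not> c (u + d)) (q - d)) + 2 * minority c q
      \<le> q * (q + 1)"
  proof (cases q)
    case (Suc p)
    have gauss: "2 * (\<Sum>d<p. p - d) = p * (p + 1)" for p :: nat
      by (induction p) (simp_all add: sum.lessThan_Suc_shift del: sum.lessThan_Suc)
    \<comment> \<open>Row 0 is split off because its left ends range over all of the first
      \<open>q\<close> vertices, and those sharing the colour of \<open>u\<close> are lost. There
      are at least \<open>minority c q\<close> of them.\<close>
    have "(\<Sum>d<q. colour_count c (\<not> c (u + d)) (q - d)) = colour_count c (\<not> c u) q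
        + (\<Sum>d<p. colour_count c (\<not> c (u + Suc d)) (p - d))"
      using Suc by (simp add: sum.lessThan_Suc_shift del: sum.lessThan_Suc)
    also have "(\<Sum>d<p. colour_count c (\<not> c (u + Suc d)) (p - d)) \<le> (\<Sum>d<p. p - d)"
      by (intro sum_mono colour_count_le)
    finally have "(\<Sum>d<q. colour_count c (\<not> c (u + d)) (q - d)) \<le>
      colour_count c (\<not> c u) q + (\<Sum>d<p. p - d)" by simp
    moreover have "colour_count c (\<not> c u) q + minority c q \<le> q"
      using colour_count_add[of c q] by (cases "c u") (auto simp: minority_def)
    ultimately have "2 * (\<Sum>d<q. colour_count c (\<not> c (u + d)) (q - d)) + 2 * minority c q
        \<le> 2 * q + p * (p + 1)"
      using gauss[of p] by linarith
    also have "\<dots> = q * (q + 1)" using Suc by simp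
    finally show ?thesis .
  qed (simp add: minority_def)
  ultimately show ?thesis by linarith
qed

section \<open>The bound for queues\<close>

text \<open>The colouring read from the far end, so that estimates for small sums also serve for
  large ones.\<close>

definition reflect :: "nat \<Rightarrow> (nat \<Rightarrow> bool) \<Rightarrow> nat \<Rightarrow> bool" where
  "reflect N c i = c (N - 1 - i)"

text \<open>Intervals with equal sum of endpoints are concentric, so one nests in the other unless
  they coincide.\<close>

lemma inj_on_sum_nonnesting:
  assumes "X \<subseteq> bichromatic c l r" "nonnesting X"
  shows "inj_on (\<lambda>(i, j). i + j) X"
proof (rule inj_onI, clarify)
  fix i j i' j' assume *: "(i, j) \<in> X" "(i', j') \<in> X" "i + j = i' + j'"
  then have "i < j" "i' < j'" using assms(1) by (auto simp: bichromatic_def)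
  then show "i = i' \<and> j = j'"
    using nonnestingD[OF assms(2) *(1,2)] nonnestingD[OF assms(2) *(2,1)] *(3) by linarith
qed

text \<open>The sums are cut into three ranges. At both ends all edges are counted by
  \<open>card_low\<close>; in the middle each queue uses each sum at most once.\<close>

lemma card_Union_nonnesting:
  assumes fin: "finite \<Q>" and q: "card \<Q> = q" and N: "6 * q < N"
    and Q: "\<And>X. X \<in> \<Q> \<Longrightarrow> X \<subseteq> bichromatic c 0 N \<and> nonnesting X"
  shows "card (\<Union>\<Q>) + 3 * q\<^sup>2 + minority c q + minority (reflect N c) q \<le> 2 * N * q"
proof -
  let ?c' = "reflect N c"
  obtain u b where u: "q \<le> u" "u \<le> 2 * q" "colour_count c b u = q"
    "colour_count c (\<not> b) u = u - q"
    by (rule exists_prefix_max_colour_count)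
  obtain u' b' where u': "q \<le> u'" "u' \<le> 2 * q" "colour_count ?c' b' u' = q"
    "colour_count ?c' (\<not> b') u' = u' - q"
    by (rule exists_prefix_max_colour_count)
  \<comment> \<open>Reflection turns a sum \<open>t\<close> into \<open>2 * N - 2 - t\<close>, so
    \<open>?hi \<le> t\<close> says that the reflected sum is below \<open>u' + q\<close>.\<close>
  let ?lo = "u + q" and ?hi = "2 * N - 1 - (u' + q)"
  let ?mid = "\<lambda>X. {(i, j) \<in> X. ?lo \<le> i + j \<and> i + j < ?hi}"
  let ?high = "{(i, j) \<in> bichromatic c 0 N. ?hi \<le> i + j}"
  have fhigh: "finite ?high"
    by (rule finite_subset[OF _ finite_bichromatic[of c 0 N]]) auto
  have fX: "finite X" if "X \<in> \<Q>" for X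
    using Q[OF that] finite_subset finite_bichromatic by blast
  have fmid: "finite (?mid X)" if "X \<in> \<Q>" for X
    by (rule finite_subset[OF _ fX[OF that]]) auto
  have high: "card ?high \<le> card (low ?c' (u' + q))"
  proof (rule card_inj_on_le)
    show "inj_on (\<lambda>(i, j). (N - 1 - j, N - 1 - i)) ?high"
      by (auto simp: inj_on_def bichromatic_def)
    show "(\<lambda>(i, j). (N - 1 - j, N - 1 - i)) ` ?high \<subseteq> low ?c' (u' + q)"
      by (auto simp: bichromatic_def low_def reflect_def)
  qed simp
  have mid: "card (?mid X) \<le> ?hi - ?lo" if "X \<in> \<Q>" for X
  proof -
    have "card (?mid X) \<le> card {?lo..<?hi}"
    proof (rule card_inj_on_le)
      show "inj_on (\<lambda>(i, j). i + j) (?mid X)"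
        by (rule inj_on_subset[OF inj_on_sum_nonnesting[of X c 0 N]]) (use Q[OF that] in auto)
    qed auto
    then show ?thesis by simp
  qed
  have "\<Union>\<Q> \<subseteq> low c ?lo \<union> (?high \<union> (\<Union>X\<in>\<Q>. ?mid X))"
  proof (rule subsetI)
    fix e assume "e \<in> \<Union>\<Q>"
    then obtain X where X: "X \<in> \<Q>" "e \<in> X" by blast
    obtain i j where e: "e = (i, j)" by (cases e)
    have "(i, j) \<in> bichromatic c 0 N" using Q[OF X(1)] X e by blast
    moreover consider "i + j < ?lo" | "?hi \<le> i + j" | "?lo \<le> i + j \<and> i + j < ?hi" by linarith
    ultimately show "e \<in> low c ?lo \<union> (?high \<union> (\<Union>X\<in>\<Q>. ?mid X))"
      using X e by cases (auto simp: low_def bichromatic_def)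
  qed
  then have "card (\<Union>\<Q>) \<le> card (low c ?lo \<union> (?high \<union> (\<Union>X\<in>\<Q>. ?mid X)))"
    by (rule card_mono[rotated]) (use fin fmid fhigh in auto)
  also have "\<dots> \<le> card (low c ?lo) + (card ?high + card (\<Union>X\<in>\<Q>. ?mid X))"
    by (intro order.trans[OF card_Un_le] add_left_mono card_Un_le)
  also have "card (\<Union>X\<in>\<Q>. ?mid X) \<le> (\<Sum>X\<in>\<Q>. ?hi - ?lo)"
    by (rule order.trans[OF card_UN_le[OF fin] sum_mono]) (rule mid)
  finally have "card (\<Union>\<Q>) \<le> card (low c ?lo) + card (low ?c' (u' + q)) + q * (?hi - ?lo)"
    using high q by simp
  then have "2 * card (\<Union>\<Q>) + 2 * minority c q + 2 * minority ?c' q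
    \<le> 2 * (q * (u - q)) + q * (q + 1) + (2 * (q * (u' - q)) + q * (q + 1)) + 2 * (q * (?hi - ?lo))"
    using card_low[OF u(1,3,4)] card_low[OF u'(1,3,4)] by linarith
  also have "\<dots> = q * (2 * (u - q) + 2 * (u' - q) + 2 * (q + 1) + 2 * (?hi - ?lo))"
    by (simp add: algebra_simps)
  \<comment> \<open>Longer prefixes contain more edges but shorten the middle range by as much, so
    \<open>u\<close> and \<open>u'\<close> cancel.\<close>
  also have "2 * (u - q) + 2 * (u' - q) + 2 * (q + 1) + 2 * (?hi - ?lo) = 4 * N - 6 * q"
  proof -
    have "?hi - ?lo + (u' + q) + (u + q) + 1 = 2 * N" using u(2) u'(2) N by linarith
    moreover obtain x y where "u = q + x" "u' = q + y"
      using u(1) u'(1) le_Suc_ex by blast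
    ultimately show ?thesis by simp
  qed
  also have "q * (4 * N - 6 * q) = 4 * N * q - 6 * q\<^sup>2"
    by (simp add: algebra_simps power2_eq_square)
  finally have "2 * card (\<Union>\<Q>) + 2 * minority c q + 2 * minority ?c' q \<le> 4 * N * q - 6 * q\<^sup>2" .
  moreover have "6 * q\<^sup>2 \<le> 4 * N * q"
    using N by (simp add: power2_eq_square)
  ultimately show ?thesis by linarith
qed

lemma changes_reflect:
  assumes "1 \<le> q" "q \<le> N"
  shows "changes c (N - q) (N - 1) = changes (reflect N c) 0 (q - 1)"
  unfolding changes_def
\<comment> \<open>The side \<open>(i, Suc i)\<close> reflects to
  \<open>(N - 2 - i, N - 1 - i)\<close>, whose left end is the new index.\<close>
proof (rule sum.reindex_bij_witness[of _ "\<lambda>i. N - 2 - i" "\<lambda>i. N - 2 - i"])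
  fix i assume i: "i \<in> {N - q..<N - 1}"
  then have "N - 1 - (N - 2 - i) = Suc i" "N - 1 - Suc (N - 2 - i) = i" by auto
  then show "of_bool (reflect N c (N - 2 - i) \<noteq> reflect N c (Suc (N - 2 - i)))
      = of_bool (c i \<noteq> c (Suc i))" unfolding reflect_def by auto
qed (use assms in auto)

text \<open>Within the first and the last \<open>q\<close> vertices, changes are limited by the
  minority counts; between these blocks there are only \<open>N - 2 * q + 1\<close> consecutive
  pairs.\<close>

lemma changes_le_minority:
  assumes q: "2 * q \<le> N"
  shows "changes c 0 (N - 1) + 2 * q \<le> N + 1 + 2 * minority c q + 2 * minority (reflect N c) q"
proof (cases "q = 0")
  case True
  then show ?thesis using changes_le[of c 0 "N - 1"] by simp
next
  case False
  then have "changes c 0 (N - 1)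
      = changes c 0 (q - 1) + changes c (q - 1) (N - q) + changes c (N - q) (N - 1)"
    using q changes_split[of 0 "q - 1" "N - 1" c] changes_split[of "q - 1" "N - q" "N - 1" c] by simp
  moreover have "changes c (q - 1) (N - q) \<le> N - q - (q - 1)" by (rule changes_le)
  moreover have "changes c' 0 (q - 1) \<le> 2 * minority c' q" for c'
    using changes_le_colour_count[of c' q True] changes_le_colour_count[of c' q False]
    by (simp add: minority_def)
  from this[of c] this[of "reflect N c"] have "changes c 0 (q - 1) \<le> 2 * minority c q"
    "changes (reflect N c) 0 (q - 1) \<le> 2 * minority (reflect N c) q" .
  moreover have "changes c (N - q) (N - 1) = changes (reflect N c) 0 (q - 1)"
    using False q by (intro changes_reflect) auto
  ultimately show ?thesis using False q by linarith
qed

section \<open>Counting edges against stacks and queues\<close>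

lemma pages_lower_bound:
  assumes n: "colour_count c True (2 * n) = n"
    and fin: "finite \<S>" "finite \<Q>"
    and S: "\<And>X. X \<in> \<S> \<Longrightarrow> X \<subseteq> bichromatic c 0 (2 * n) \<and> noncrossing X"
    and Q: "\<And>X. X \<in> \<Q> \<Longrightarrow> X \<subseteq> bichromatic c 0 (2 * n) \<and> nonnesting X"
    and cover: "bichromatic c 0 (2 * n) \<subseteq> \<Union>\<S> \<union> \<Union>\<Q>"
  shows "n \<le> 3 * (card \<S> + card \<Q>)"
proof (rule ccontr)
  define s q where "s = card \<S>" and "q = card \<Q>"
  assume "\<not> ?thesis"
  then have large: "3 * s + 3 * q < n" by (simp add: s_def q_def)
  let ?N = "2 * n"
  define \<mu> where "\<mu> = minority c q + minority (reflect ?N c) q"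
  have "colour_count c False ?N = n" using n colour_count_add[of c ?N] by simp
  then have "n * n = card (bichromatic c 0 ?N)" using n by (simp add: card_bichromatic)
  also have "\<dots> \<le> card (\<Union>\<S> \<union> \<Union>\<Q>)"
  proof (rule card_mono[OF _ cover])
    have "finite X" if "X \<in> \<S> \<union> \<Q>" for X
      using that S[of X] Q[of X] finite_subset[OF _ finite_bichromatic[of c 0 ?N], of X] by auto
    then show "finite (\<Union>\<S> \<union> \<Union>\<Q>)" using fin by simp
  qed
  also have "\<dots> \<le> card (\<Union>\<S>) + card (\<Union>\<Q>)" by (rule card_Un_le)
  finally have nn: "n * n \<le> card (\<Union>\<S>) + card (\<Union>\<Q>)" .
  have "card (\<Union>\<Q>) + 3 * q\<^sup>2 + minority c q + minority (reflect ?N c) q \<le> 2 * ?N * q"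
    by (rule card_Union_nonnesting) (use fin large Q q_def in auto)
  then have "card (\<Union>\<Q>) + 3 * q * q + \<mu> \<le> 4 * n * q"
    by (simp add: power2_eq_square \<mu>_def)
  then have "int (card (\<Union>\<Q>) + 3 * q * q + \<mu>) \<le> int (4 * n * q)"
    by (rule of_nat_mono)
  then have queues: "int (card (\<Union>\<Q>)) + 3 * int q * int q + int \<mu> \<le> 4 * int n * int q"
    by (simp only: of_nat_add of_nat_mult of_nat_numeral)
  \<comment> \<open>The edges that the queues leave to the stacks:
    \<open>n * n - 4 * n * q + 3 * q * q\<close> factorises, and \<open>\<mu>\<close> is the gain
    from the minority vertices.\<close>
  have main: "(int n - int q) * (int n - 3 * int q) + int \<mu> \<le> int (card (\<Union>\<S>))"
  proof -
    have "int n * int n \<le> int (card (\<Union>\<S>)) + int (card (\<Union>\<Q>))"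
      using of_nat_mono[OF nn, where ?'a = int] by (simp only: of_nat_add of_nat_mult)
    moreover have "(int n - int q) * (int n - 3 * int q)
        = int n * int n - 4 * int n * int q + 3 * int q * int q" by (simp add: algebra_simps)
    ultimately show ?thesis using queues by linarith
  qed
  \<comment> \<open>The strict inequality \<open>large\<close> between integers gives
    \<open>n - 3 * q \<ge> 3 * s + 1\<close>.\<close>
  have prod: "(int n - int q) * (3 * int s + 1) \<le> (int n - int q) * (int n - 3 * int q)"
    by (rule mult_left_mono) (use large in auto)
  show False
  proof (cases "s = 0")
    case True
    then have "card (\<Union>\<S>) = 0" using fin by (simp add: s_def)
    moreover have "int n - int q \<le> (int n - int q) * (int n - 3 * int q)"
      using prod unfolding True by (simp only: of_nat_0 mult_zero_right add_0 mult_1_right)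
    ultimately show False using main large by linarith
  next
    case False
    define M where "M = changes c 0 (?N - 1) + of_bool (c 0 \<noteq> c (?N - 1))"
    have "2 * int (card (\<Union>\<S>)) \<le> int (card \<S>) * (2 * int (?N - 1) - 2 - int M) + 2 * int M"
      unfolding M_def
    proof (rule card_Union_noncrossing)
      show "1 < ?N - 1" using large False by linarith
      show "\<S> \<noteq> {}" using False by (auto simp: s_def)
      show "X \<subseteq> bichromatic c 0 (Suc (?N - 1)) \<and> noncrossing X" if "X \<in> \<S>" for X
        using S[OF that] large by simp
    qed (rule fin)
    then have stacks: "2 * int (card (\<Union>\<S>)) \<le> int s * (4 * int n - 4 - int M) + 2 * int M"
      using large by (simp add: s_def of_nat_diff)
    show False
    proof (cases "s = 1")
      case True
      \<comment> \<open>The closing side raises the constant from 1 to 2. Inserted below,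
        \<open>2 * \<mu>\<close> cancels and \<open>2 * n \<le> 6 * q - 2\<close> remains,
        contradicting \<open>3 * q < n\<close>.\<close>
      have "M + 2 * q \<le> 2 * n + 2 + 2 * \<mu>"
        using changes_le_minority[of q ?N c] large
        unfolding M_def \<mu>_def by (cases "c 0 \<noteq> c (?N - 1)") simp_all
      then have "int M + 2 * int q \<le> 2 * int n + 2 + 2 * int \<mu>" by linarith
      moreover have "(int n - int q) * 4 + int \<mu> \<le> int (card (\<Union>\<S>))"
        using main prod True by simp
      moreover have "2 * int (card (\<Union>\<S>)) \<le> 4 * int n - 4 + int M"
        using stacks True by simp
      moreover have "3 * int q < int n" using large by linarith
      ultimately show False by (simp add: algebra_simps)
    next
      case False
      \<comment> \<open>With two or more stacks, the \<open>M / 2\<close> lost in each stack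
        outweighs the sides counted once.\<close>
      with \<open>s \<noteq> 0\<close> have "int s * int M \<ge> 2 * int M" by (intro mult_right_mono) auto
      then have "int (card (\<Union>\<S>)) \<le> int s * (2 * int n) - 2 * int s"
        using stacks by (simp add: algebra_simps)
      moreover have "int s * (2 * int n) \<le> int s * (3 * (int n - int q))"
        by (rule mult_left_mono) (use large in auto)
      moreover have "(int n - int q) * (3 * int s + 1)
          = int s * (3 * (int n - int q)) + (int n - int q)" by (simp add: algebra_simps)
      moreover have "int q < int n" using large by linarith
      ultimately show False using main prod by linarith
    qed
  qed
qed

section \<open>From graph layouts to index pairs\<close>

text \<open>The position of a vertex is its number of predecessors; a later vertex has strictly
  more, since the earlier one joins them.\<close>

lemma strict_linear_order_on_rank:
  assumes fin: "finite V" and lin: "strict_linear_order_on V r"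
  obtains pos where "bij_betw pos V {..<card V}"
    "\<And>x y. x \<in> V \<Longrightarrow> y \<in> V \<Longrightarrow> pos x < pos y \<longleftrightarrow> (x, y) \<in> r"
proof -
  define pos where "pos x = card {z \<in> V. (z, x) \<in> r}" for x
  have tr: "trans r" and ir: "irrefl r" and tot: "total_on V r"
    using lin by (auto simp: strict_linear_order_on_def)
  have mono: "pos x < pos y" if "x \<in> V" "y \<in> V" "(x, y) \<in> r" for x y
    unfolding pos_def
  proof (rule psubset_card_mono)
    have "x \<notin> {z \<in> V. (z, x) \<in> r}" using ir by (auto simp: irrefl_def)
    then show "{z \<in> V. (z, x) \<in> r} \<subset> {z \<in> V. (z, y) \<in> r}"
      using that by (auto dest: transD[OF tr])
  qed (use fin in simp)
  have inj: "inj_on pos V"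
    using tot mono by (intro inj_onI) (metis less_irrefl total_on_def)
  have "pos ` V \<subseteq> {..<card V}"
  proof (rule image_subsetI)
    fix x assume x: "x \<in> V"
    then have "{z \<in> V. (z, x) \<in> r} \<subset> V" using ir by (auto simp: irrefl_def)
    then show "pos x \<in> {..<card V}" using fin by (simp add: pos_def psubset_card_mono)
  qed
  then have "pos ` V = {..<card V}"
    by (rule card_subset_eq[rotated]) (simp_all add: card_image[OF inj])
  with inj have "bij_betw pos V {..<card V}" by (simp add: bij_betw_def)
  moreover have "pos x < pos y \<longleftrightarrow> (x, y) \<in> r" if "x \<in> V" "y \<in> V" for x y
    using that mono tot by (metis less_asym less_irrefl total_on_def)
  ultimately show thesis by (rule that)
qed

lemma mixed_layout_complete_bipartite:
  assumes K: "complete_bipartite_digraph n n G" and lay: "mixed_layout G s q"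
  shows "n \<le> 3 * (s + q)"
proof -
  interpret graph G using K by (simp add: complete_bipartite_digraph_def)
  obtain U W where UW: "verts G = U \<union> W" "U \<inter> W = {}" "card U = n" "card W = n"
    "arcs_ends G = U \<times> W \<union> W \<times> U"
    using K by (auto simp: complete_bipartite_digraph_def)
  have fin: "finite U" "finite W" using UW(1) finite_verts by (metis finite_Un)+
  then have cV: "card (verts G) = 2 * n" using UW by (simp add: card_Un_disjoint)
  obtain r \<S> \<Q> where lin: "strict_linear_order_on (verts G) r"
    and S: "finite \<S>" "card \<S> = s" "\<And>X. X \<in> \<S> \<Longrightarrow> is_stack r X"
    and Q: "finite \<Q>" "card \<Q> = q" "\<And>X. X \<in> \<Q> \<Longrightarrow> is_queue r X"
    and part: "partition_on (uedges G) (\<S> \<union> \<Q>)"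
    using lay unfolding mixed_layout_def by blast
  obtain pos where bij: "bij_betw pos (verts G) {..<2 * n}"
    and pos: "\<And>x y. x \<in> verts G \<Longrightarrow> y \<in> verts G \<Longrightarrow> pos x < pos y \<longleftrightarrow> (x, y) \<in> r"
    using strict_linear_order_on_rank[OF finite_verts lin] unfolding cV by blast
  have inj: "inj_on pos (verts G)" and img: "pos ` verts G = {..<2 * n}"
    using bij by (auto simp: bij_betw_def)
  define c where "c i \<longleftrightarrow> i \<in> pos ` U" for i
  have cU: "c (pos x) \<longleftrightarrow> x \<in> U" if "x \<in> verts G" for x
    using inj_on_image_mem_iff[OF inj that, of U] UW(1) by (simp add: c_def)
  \<comment> \<open>The smaller position comes first, so each edge of a page yields a single
    pair.\<close>
  define trace where "trace P = {(pos x, pos y) |x y.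
    x \<in> verts G \<and> y \<in> verts G \<and> {x, y} \<in> P \<and> pos x < pos y}" for P
  have edge: "{x, y} \<in> uedges G \<longleftrightarrow> (x \<in> U) \<noteq> (y \<in> U)" if "x \<in> verts G" "y \<in> verts G" for x y
    using that UW by (auto simp: uedges_def doubleton_eq_iff)
  have sub: "trace P \<subseteq> bichromatic c 0 (2 * n)" if "P \<in> \<S> \<union> \<Q>" for P
  proof
    fix e assume "e \<in> trace P"
    then obtain x y where e: "e = (pos x, pos y)" "x \<in> verts G" "y \<in> verts G" "{x, y} \<in> P"
      "pos x < pos y" by (auto simp: trace_def)
    have "{x, y} \<in> uedges G" using partition_onD1[OF part] that e by blast
    moreover have "pos y < 2 * n" using img e by blast
    ultimately show "e \<in> bichromatic c 0 (2 * n)"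
      using e edge cU by (auto simp: bichromatic_def)
  qed
  have "n \<le> 3 * (card (trace ` \<S>) + card (trace ` \<Q>))"
  proof (rule pages_lower_bound)
    have "{i. i < 2 * n \<and> c i = True} = pos ` U"
      using img UW(1) by (auto simp: c_def)
    then show "colour_count c True (2 * n) = n"
      using card_image[OF inj_on_subset[OF inj, of U]] UW by (simp add: colour_count_def)
    show "X \<subseteq> bichromatic c 0 (2 * n) \<and> noncrossing X" if X: "X \<in> trace ` \<S>" for X
    proof
      obtain P where P: "P \<in> \<S>" "X = trace P" using X by blast
      then show "X \<subseteq> bichromatic c 0 (2 * n)" using sub by simp
      have "\<not> crosses r e f" if "e \<in> P" "f \<in> P" for e f
        using S(3)[OF P(1)] that by (simp add: is_stack_def)
      note no = this
      have False if ij: "(i, j) \<in> X" "(i', j') \<in> X" and lt: "i < i' \<and> i' < j \<and> j < j'" for i j i' j'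
      proof -
        obtain x y where x: "i = pos x" "j = pos y" "x \<in> verts G" "y \<in> verts G" "{x, y} \<in> P"
          using ij(1) P(2) by (auto simp: trace_def)
        obtain x' y' where x': "i' = pos x'" "j' = pos y'" "x' \<in> verts G" "y' \<in> verts G"
          "{x', y'} \<in> P"
          using ij(2) P(2) by (auto simp: trace_def)
        have "(x, x') \<in> r \<and> (x', y) \<in> r \<and> (y, y') \<in> r" using lt pos x x' by simp
        then have "crosses r {x, y} {x', y'}" unfolding crosses_def by blast
        then show False using no x x' by blast
      qed
      then show "noncrossing X" unfolding noncrossing_def by blast
    qed
    show "X \<subseteq> bichromatic c 0 (2 * n) \<and> nonnesting X" if X: "X \<in> trace ` \<Q>" for X
    proof
      obtain P where P: "P \<in> \<Q>" "X = trace P" using X by blast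
      then show "X \<subseteq> bichromatic c 0 (2 * n)" using sub by simp
      have "\<not> nests r e f" if "e \<in> P" "f \<in> P" for e f
        using Q(3)[OF P(1)] that by (simp add: is_queue_def)
      note no = this
      have False if ij: "(i, j) \<in> X" "(i', j') \<in> X" and lt: "i < i' \<and> i' < j' \<and> j' < j" for i j i' j'
      proof -
        obtain x y where x: "i = pos x" "j = pos y" "x \<in> verts G" "y \<in> verts G" "{x, y} \<in> P"
          using ij(1) P(2) by (auto simp: trace_def)
        obtain x' y' where x': "i' = pos x'" "j' = pos y'" "x' \<in> verts G" "y' \<in> verts G"
          "{x', y'} \<in> P"
          using ij(2) P(2) by (auto simp: trace_def)
        have "(x, x') \<in> r \<and> (x', y') \<in> r \<and> (y', y) \<in> r" using lt pos x x' by simp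
        then have "nests r {x, y} {x', y'}" unfolding nests_def by blast
        then show False using no x x' by blast
      qed
      then show "nonnesting X" unfolding nonnesting_def by blast
    qed
    show "bichromatic c 0 (2 * n) \<subseteq> \<Union>(trace ` \<S>) \<union> \<Union>(trace ` \<Q>)"
    proof
      fix e assume "e \<in> bichromatic c 0 (2 * n)"
      then obtain i j where e: "e = (i, j)" "i < j" "j < 2 * n" "c i \<noteq> c j"
        by (auto simp: bichromatic_def)
      have "i \<in> pos ` verts G" "j \<in> pos ` verts G" using e unfolding img by auto
      then obtain x y where xy: "i = pos x" "j = pos y" "x \<in> verts G" "y \<in> verts G" by blast
      then have "{x, y} \<in> uedges G" using e edge cU by simp
      then obtain P where P: "P \<in> \<S> \<union> \<Q>" "{x, y} \<in> P" using partition_onD1[OF part] by blast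
      then have "e \<in> trace P" using e xy by (auto simp: trace_def)
      then show "e \<in> \<Union>(trace ` \<S>) \<union> \<Union>(trace ` \<Q>)" using P by blast
    qed
  qed (use S Q in auto)
  \<comment> \<open>Passing to traces cannot increase the number of pages.\<close>
  also have "\<dots> \<le> 3 * (s + q)"
    using card_image_le[OF S(1), of trace] card_image_le[OF Q(1), of trace] S(2) Q(2) by simp
  finally show ?thesis .
qed

theorem theorem5:
  fixes n :: nat and G :: "('a, 'b) pre_digraph"
  assumes "n \<ge> 1"
    and "complete_bipartite_digraph n n G"
  shows "int (mixed_page_number G) \<ge> \<lceil>real n / 3\<rceil>"
proof -
  have "graph G" using assms(2) by (simp add: complete_bipartite_digraph_def)
  then obtain s q where sq: "mixed_page_number G = s + q" "mixed_layout G s q"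
    using mixed_page_number_attained by blast
  then have "n \<le> 3 * mixed_page_number G"
    using mixed_layout_complete_bipartite[OF assms(2)] by simp
  then have "real n / 3 \<le> of_int (int (mixed_page_number G))" by simp
  then show ?thesis by (simp only: ceiling_le_iff)
qed

end
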